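(* Let $(G,\mathscr L)$ be an affine plane of order $n\geq 3$ and let $D\subseteq G$ be a set of $k\leq n-2$ points. Let $\mathscr L_D=\{L\setminus D: L\in\mathscr L\}$, so that $(G\setminus D,\mathscr L_D)$ is the induced linear subspace on $G\setminus D$. Define a relation $\varpi$ on $\mathscr L_D$ by declaring $L\setminus D$ and $M\setminus D$ (for $L,M\in\mathscr L$) related iff either $|L\cap D|=|M\cap D|=1$ and $L\cap D=M\cap D$, or neither $L$ nor $M$ meets $D$ in exactly one point and $L,M$ are parallel in $(G,\mathscr L)$ (i.e. equal or disjoint). Then $\varpi$ is a parallelism of $(G\setminus D,\mathscr L_D)$ with exactly $n+k+1$ blocks.
   Context: An affine plane of order $n$ is a linear space on $n^2$ points in which every line has $n$ points and, for every line $L$ and point $p\notin L$, there is a unique line through $p$ disjoint from $L$; it has $n+1$ parallel classes, each consisting of $n$ pairwise disjoint lines, and each point lies on $n+1$ lines. A linear space is a pair $(G,\mathscr L)$ of a set of points and a family of subsets (lines) such that every two distinct points lie on a line, two distinct lines meet in at most one point, and every line has at least two points. A parallelism of a linear space is an equivalence relation on its lines such that distinct lines in the same block are disjoint. *)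

theory Defs
  imports Main
begin

locale linear_space =
  fixes points :: "'a set" and lines :: "'a set set"
  assumes lines_subset: "L \<in> lines \<Longrightarrow> L \<subseteq> points"
    and joining_line: "\<lbrakk>x \<in> points; y \<in> points; x \<noteq> y\<rbrakk> \<Longrightarrow> \<exists>L\<in>lines. x \<in> L \<and> y \<in> L"
    and meet_at_most_one:
      "\<lbrakk>L \<in> lines; M \<in> lines; L \<noteq> M; x \<in> L \<inter> M; y \<in> L \<inter> M\<rbrakk> \<Longrightarrow> x = y"
    and two_points: "L \<in> lines \<Longrightarrow> \<exists>x\<in>L. \<exists>y\<in>L. x \<noteq> y"

text \<open>The counts of parallel classes, of lines in a parallel class and of lines through a point
  follow from these axioms and are not assumed.\<close>

locale affine_plane = linear_space points lines
  for order :: nat and points :: "'a set" and lines :: "'a set set" +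
  assumes finite_points: "finite points"
    and card_points: "card points = order ^ 2"
    and card_line: "L \<in> lines \<Longrightarrow> card L = order"
    and unique_parallel:
      "\<lbrakk>L \<in> lines; p \<in> points; p \<notin> L\<rbrakk> \<Longrightarrow> \<exists>!M. M \<in> lines \<and> p \<in> M \<and> L \<inter> M = {}"

locale parallelism = linear_space points lines
  for points :: "'a set" and lines :: "'a set set" and r :: "('a set \<times> 'a set) set" +
  assumes equiv_lines: "equiv lines r"
    and block_disjoint: "\<lbrakk>(L, M) \<in> r; L \<noteq> M\<rbrakk> \<Longrightarrow> L \<inter> M = {}"

definition residual_lines :: "'a set set \<Rightarrow> 'a set \<Rightarrow> 'a set set" where
  "residual_lines lines D = {L - D | L. L \<in> lines}"

definition varpi_cond :: "'a set \<Rightarrow> 'a set \<Rightarrow> 'a set \<Rightarrow> bool" where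
  "varpi_cond D L M \<longleftrightarrow>
     (card (L \<inter> D) = 1 \<and> card (M \<inter> D) = 1 \<and> L \<inter> D = M \<inter> D)
   \<or> (card (L \<inter> D) \<noteq> 1 \<and> card (M \<inter> D) \<noteq> 1 \<and> (L = M \<or> L \<inter> M = {}))"

definition varpi :: "'a set set \<Rightarrow> 'a set \<Rightarrow> ('a set \<times> 'a set) set" where
  "varpi lines D = {(L - D, M - D) | L M. L \<in> lines \<and> M \<in> lines \<and> varpi_cond D L M}"

text \<open>If \<open>D\<close> has at most \<open>n - 2\<close> points, a line \<open>L\<close> is determined by \<open>L - D\<close>, so \<^const>\<open>varpi\<close>
  does not depend on the choice of representatives.\<close>

lemma (in affine_plane) inj_on_residual:
  assumes "D \<subseteq> points" "card D \<le> order - 2" "order \<ge> 3"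
  shows "inj_on (\<lambda>L. L - D) lines"
proof (rule inj_onI, rule ccontr)
  fix L M assume LM: "L \<in> lines" "M \<in> lines" "L - D = M - D" "L \<noteq> M"
  have "card L - card D \<le> card (L - D)"
    by (rule diff_card_le_card_Diff) (use assms finite_points finite_subset in blast)
  then have "2 \<le> card (L - D)"
    using assms card_line[OF LM(1)] by linarith
  moreover have "\<forall>x\<in>L - D. \<forall>y\<in>L - D. x = y"
    using LM meet_at_most_one by blast
  then have "card (L - D) \<le> 1"
    by (cases "finite (L - D)") (simp add: card_le_Suc0_iff_eq, simp)
  ultimately show False by linarith
qed

lemma (in affine_plane) varpi_iff:
  assumes "D \<subseteq> points" "card D \<le> order - 2" "order \<ge> 3" and "L \<in> lines" "M \<in> lines"
  shows "(L - D, M - D) \<in> varpi lines D \<longleftrightarrow> varpi_cond D L M"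
proof
  assume "(L - D, M - D) \<in> varpi lines D"
  then obtain L' M' where *: "L - D = L' - D" "M - D = M' - D" "L' \<in> lines" "M' \<in> lines"
      "varpi_cond D L' M'"
    unfolding varpi_def by auto
  have "L = L'" "M = M'"
    using inj_onD[OF inj_on_residual[OF assms(1-3)] *(1) assms(4) *(3)]
      inj_onD[OF inj_on_residual[OF assms(1-3)] *(2) assms(5) *(4)] by simp_all
  with *(5) show "varpi_cond D L M"
    by simp
next
  assume "varpi_cond D L M"
  with assms(4,5) show "(L - D, M - D) \<in> varpi lines D"
    unfolding varpi_def by (intro CollectI exI conjI) (rule refl)
qed

end

theory Submission
  imports Defs
begin

text \<open>The relation \<^const>\<open>varpi\<close> is the kernel of a map on the lines: a line meeting \<open>D\<close> in exactly
  one point is sent to that point, any other line to its parallel class. So it is an equivalence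
  whose blocks correspond to the values of this map. All points of \<open>D\<close> and all \<open>n + 1\<close> parallel
  classes are values: otherwise \<open>G\<close> would be covered by at most \<open>card D < n\<close> lines.\<close>

section \<open>Kernels of maps and the number of their blocks\<close>

lemma equiv_kernel_on: "equiv A {(x, y). x \<in> A \<and> y \<in> A \<and> f x = f y}"
  by (rule equivI) (auto simp: refl_on_def sym_def trans_def)

text \<open>The blocks are the nonempty fibres of \<open>f\<close>, and a value is recovered from
  its nonempty fibre.\<close>

lemma card_quotient_kernel_on: "card (A // {(x, y). x \<in> A \<and> y \<in> A \<and> f x = f y}) = card (f ` A)"
proof -
  have "{(x, y). x \<in> A \<and> y \<in> A \<and> f x = f y} `` {a} = {x \<in> A. f x = f a}" if "a \<in> A" for a
    using that by auto
  then have "A // {(x, y). x \<in> A \<and> y \<in> A \<and> f x = f y} = (\<lambda>b. {x \<in> A. f x = b}) ` f ` A"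
    unfolding quotient_def UNION_singleton_eq_range image_image by (intro image_cong refl)
  moreover have "inj_on (\<lambda>b. {x \<in> A. f x = b}) (f ` A)"
    by (rule inj_onI) blast
  ultimately show ?thesis
    by (simp add: card_image)
qed

section \<open>Coverings by lines and the lines through a point\<close>

context affine_plane
begin

lemma finite_lines: "finite lines"
  by (rule finite_subset[of _ "Pow points"]) (use lines_subset finite_points in auto)

lemma finite_line: "L \<in> lines \<Longrightarrow> finite L"
  using lines_subset finite_points finite_subset by blast

lemma line_eqI:
  "\<lbrakk>L \<in> lines; M \<in> lines; x \<in> L; x \<in> M; y \<in> L; y \<in> M; x \<noteq> y\<rbrakk> \<Longrightarrow> L = M"
  using meet_at_most_one by blast

text \<open>Each line covers only \<open>order\<close> of the \<open>order * order\<close> points,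
  so the union bound leaves \<open>order * order \<le> card E * order\<close>, and a factor
  cancels.\<close>

lemma order_le_card_cover:
  assumes "finite E" "\<And>e. e \<in> E \<Longrightarrow> P e \<in> lines" "points \<subseteq> (\<Union>e\<in>E. P e)" "order > 0"
  shows "order \<le> card E"
proof -
  have "order * order \<le> card (\<Union>e\<in>E. P e)"
    using assms card_mono[of "\<Union>e\<in>E. P e" points] finite_line
    by (simp add: card_points power2_eq_square)
  also have "\<dots> \<le> (\<Sum>e\<in>E. card (P e))"
    using assms(1) by (rule card_UN_le)
  also have "\<dots> = card E * order"
    using assms(2) card_line by simp
  finally show ?thesis
    using assms(4) by simp
qed

lemma line_through:
  assumes "p \<in> points" "order \<ge> 2"
  shows "\<exists>L\<in>lines. p \<in> L"
proof -
  have "points \<noteq> {p}"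
    using card_points assms(2) by (auto simp: power2_eq_square)
  then obtain q where "q \<in> points" "q \<noteq> p"
    using assms(1) by blast
  then show ?thesis
    using joining_line assms(1) by blast
qed

text \<open>The lines through \<open>p\<close>, with \<open>p\<close> taken out, partition the other
  \<open>order ^ 2 - 1\<close> points into sets of size \<open>order - 1\<close>.\<close>

lemma card_pencil:
  assumes "p \<in> points" "order \<ge> 2"
  shows "card {L \<in> lines. p \<in> L} = order + 1"
proof -
  let ?S = "{L \<in> lines. p \<in> L}"
  have "points - {p} = (\<Union>L\<in>?S. L - {p})"
    using joining_line[OF assms(1)] lines_subset by blast
  then have "card (points - {p}) = (\<Sum>L\<in>?S. card (L - {p}))"
    using finite_lines finite_line
    by (simp only:) (rule card_UN_disjoint, simp, simp, use line_eqI[of _ _ p] in blast)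
  also have "\<dots> = card ?S * (order - 1)"
    using card_line by (simp add: finite_line)
  finally have "order ^ 2 - 1 = card ?S * (order - 1)"
    using assms(1) by (simp add: card_points finite_points)
  moreover have "order ^ 2 - 1 = (order + 1) * (order - 1)"
    by (simp add: power2_eq_square algebra_simps)
  ultimately have eq: "card ?S * (order - 1) = (order + 1) * (order - 1)"
    by simp
  have "order - 1 \<noteq> 0"
    using assms(2) by simp
  with eq show ?thesis
    by (simp only: mult_cancel2 simp_thms)
qed

section \<open>Parallel classes\<close>

definition parallel_class :: "'a set \<Rightarrow> 'a set set" where
  "parallel_class L = {M \<in> lines. L = M \<or> L \<inter> M = {}}"

text \<open>If \<open>x\<close> lies on \<open>L\<close>, both lines meet \<open>L\<close> and hence
  equal it; otherwise both are the unique parallel to \<open>L\<close> through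
  \<open>x\<close>.\<close>

lemma parallel_eqI:
  assumes "L \<in> lines" "M \<in> parallel_class L" "N \<in> parallel_class L" "x \<in> M" "x \<in> N"
  shows "M = N"
  using assms unique_parallel[of L x] lines_subset unfolding parallel_class_def by blast

text \<open>This is transitivity of parallelism: two lines parallel to \<open>L\<close> coincide as
  soon as they share a point. Applied in both directions it gives equality of classes.\<close>

lemma parallel_class_subset:
  assumes "L \<in> lines" "M \<in> parallel_class L"
  shows "parallel_class L \<subseteq> parallel_class M"
proof
  fix N assume N: "N \<in> parallel_class L"
  then have "M = N \<or> M \<inter> N = {}"
    using parallel_eqI[OF assms] by blast
  then show "N \<in> parallel_class M"
    using N unfolding parallel_class_def by blast
qed

lemma parallel_class_eq_iff:
  assumes "L \<in> lines" "M \<in> lines"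
  shows "parallel_class L = parallel_class M \<longleftrightarrow> L = M \<or> L \<inter> M = {}"
proof
  assume "parallel_class L = parallel_class M"
  moreover have "M \<in> parallel_class M"
    using assms(2) unfolding parallel_class_def by simp
  ultimately show "L = M \<or> L \<inter> M = {}"
    unfolding parallel_class_def by blast
next
  assume "L = M \<or> L \<inter> M = {}"
  then have "M \<in> parallel_class L" "L \<in> parallel_class M"
    using assms unfolding parallel_class_def by blast+
  then show "parallel_class L = parallel_class M"
    using parallel_class_subset assms by blast
qed

lemma parallel_through:
  assumes "L \<in> lines" "p \<in> points"
  shows "\<exists>M\<in>parallel_class L. p \<in> M"
  using assms unique_parallel[of L p] unfolding parallel_class_def by blast

text \<open>Each class has exactly one line through a fixed point \<open>p\<close>, so the classes
  are as many as the lines through \<open>p\<close>.\<close>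

lemma card_parallel_classes:
  assumes "order \<ge> 2"
  shows "card (parallel_class ` lines) = order + 1"
proof -
  have "points \<noteq> {}"
    using card_points assms by auto
  then obtain p where p: "p \<in> points"
    by blast
  let ?S = "{L \<in> lines. p \<in> L}"
  have "parallel_class L \<in> parallel_class ` ?S" if L: "L \<in> lines" for L
  proof -
    obtain M where M: "M \<in> parallel_class L" "p \<in> M"
      using parallel_through[OF L p] by blast
    then have "M \<in> lines" "L = M \<or> L \<inter> M = {}"
      unfolding parallel_class_def by auto
    then show ?thesis
      using parallel_class_eq_iff[OF L] M(2) by blast
  qed
  then have "parallel_class ` lines = parallel_class ` ?S"
    by blast
  moreover have "inj_on parallel_class ?S"
    by (rule inj_onI) (use parallel_class_eq_iff in blast)
  ultimately show ?thesis
    using card_pencil[OF p assms] by (simp add: card_image)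
qed

section \<open>Lines meeting \<open>D\<close> in one prescribed point, and lines missing
  \<open>D\<close>\<close>

text \<open>Otherwise every line through \<open>d\<close> contains a second point of
  \<open>D\<close>, and the at most \<open>card D - 1\<close> lines joining \<open>d\<close> to the
  rest of \<open>D\<close> cover the plane.\<close>

lemma exists_tangent:
  assumes "d \<in> D" "D \<subseteq> points" "card D \<le> order" "order \<ge> 2"
  shows "\<exists>L\<in>lines. L \<inter> D = {d}"
proof (rule ccontr)
  assume no_tangent: "\<not> (\<exists>L\<in>lines. L \<inter> D = {d})"
  have "finite D"
    using assms(2) finite_points finite_subset by blast
  have d: "d \<in> points"
    using assms(1,2) by blast
  have "\<forall>e\<in>D - {d}. \<exists>L\<in>lines. d \<in> L \<and> e \<in> L"
    using joining_line d assms(2) by blast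
  then obtain P where P: "\<And>e. e \<in> D - {d} \<Longrightarrow> P e \<in> lines \<and> d \<in> P e \<and> e \<in> P e"
    by metis
  have "x \<in> (\<Union>e\<in>D - {d}. P e)" if x: "x \<in> points" for x
  proof -
    \<comment> \<open>\<open>line_through\<close> serves the case \<open>x = d\<close>, where
      \<open>joining_line\<close> does not apply.\<close>
    obtain L where L: "L \<in> lines" "d \<in> L" "x \<in> L"
      using joining_line[OF d x] line_through[OF d assms(4)] by blast
    then obtain e where e: "e \<in> L" "e \<in> D - {d}"
      using no_tangent assms(1) by blast
    then have "P e = L"
      using P[OF e(2)] L line_eqI[of "P e" L d e] by blast
    then show ?thesis
      using e(2) L(3) by blast
  qed
  then have "order \<le> card (D - {d})"
    using P \<open>finite D\<close> assms(4) by (intro order_le_card_cover[of _ P]) auto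
  moreover have "card (D - {d}) < card D"
    using \<open>finite D\<close> assms(1) by (rule card_Diff1_less)
  ultimately show False
    using assms(3) by linarith
qed

text \<open>The class of \<open>L\<close> covers the plane. If all its lines met \<open>D\<close>,
  those through points of \<open>D\<close> would already do so. Here every point of \<open>D\<close>
  contributes a line, hence the strict bound on \<open>card D\<close>.\<close>

lemma exists_parallel_disjoint:
  assumes "L \<in> lines" "D \<subseteq> points" "card D < order"
  shows "\<exists>M\<in>parallel_class L. M \<inter> D = {}"
proof (rule ccontr)
  assume meets: "\<not> (\<exists>M\<in>parallel_class L. M \<inter> D = {})"
  have "finite D"
    using assms(2) finite_points finite_subset by blast
  have "\<forall>e\<in>D. \<exists>M\<in>parallel_class L. e \<in> M"
    using parallel_through[OF assms(1)] assms(2) by blast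
  then obtain P where P: "\<And>e. e \<in> D \<Longrightarrow> P e \<in> parallel_class L \<and> e \<in> P e"
    by metis
  have "x \<in> (\<Union>e\<in>D. P e)" if x: "x \<in> points" for x
  proof -
    obtain M where M: "M \<in> parallel_class L" "x \<in> M"
      using parallel_through[OF assms(1) x] by blast
    then obtain e where e: "e \<in> M" "e \<in> D"
      using meets by blast
    then have "P e = M"
      using P[OF e(2)] M parallel_eqI[OF assms(1)] by blast
    then show ?thesis
      using e(2) M(2) by blast
  qed
  then have "order \<le> card D"
    using P \<open>finite D\<close> assms(3)
    by (intro order_le_card_cover[of _ P]) (auto simp: parallel_class_def)
  then show False
    using assms(3) by linarith
qed

section \<open>The map with kernel \<open>varpi\<close> and its values\<close>

text \<open>The sum type keeps the two kinds of value apart, so their numbers add up. Keeping the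
  singleton \<open>L \<inter> D\<close> instead of its element makes equality of values match
  \<open>varpi_cond\<close>.\<close>

definition direction :: "'a set \<Rightarrow> 'a set \<Rightarrow> 'a set + 'a set set" where
  "direction D L = (if card (L \<inter> D) = 1 then Inl (L \<inter> D) else Inr (parallel_class L))"

lemma varpi_cond_iff:
  assumes "L \<in> lines" "M \<in> lines"
  shows "varpi_cond D L M \<longleftrightarrow> direction D L = direction D M"
  using parallel_class_eq_iff[OF assms] unfolding varpi_cond_def direction_def by auto

text \<open>The bound on \<open>card D\<close> enters in the inclusion from right to left, where
  every point of \<open>D\<close> and every parallel class must be attained.\<close>

lemma direction_image:
  assumes "D \<subseteq> points" "card D < order" "order \<ge> 2"
  shows "direction D ` lines = Inl ` (\<lambda>d. {d}) ` D \<union> Inr ` parallel_class ` lines"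
proof (intro equalityI subsetI)
  fix b assume "b \<in> direction D ` lines"
  then obtain L where L: "L \<in> lines" "b = direction D L"
    by blast
  show "b \<in> Inl ` (\<lambda>d. {d}) ` D \<union> Inr ` parallel_class ` lines"
  proof (cases "card (L \<inter> D) = 1")
    case True
    then obtain d where "L \<inter> D = {d}"
      by (auto simp: card_1_singleton_iff)
    then have "d \<in> D" "b = Inl {d}"
      using L(2) True by (auto simp: direction_def)
    then show ?thesis
      by blast
  next
    case False
    then show ?thesis
      using L by (simp add: direction_def)
  qed
next
  fix b :: "'a set + 'a set set"
  assume "b \<in> Inl ` (\<lambda>d. {d}) ` D \<union> Inr ` parallel_class ` lines"
  then consider d where "d \<in> D" "b = Inl {d}" | L where "L \<in> lines" "b = Inr (parallel_class L)"
    by blast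
  then show "b \<in> direction D ` lines"
  proof cases
    case 1
    then obtain L where "L \<in> lines" "L \<inter> D = {d}"
      using exists_tangent[OF _ assms(1)] assms(2,3) by (meson less_imp_le)
    then show ?thesis
      using 1(2) by (intro image_eqI[of _ _ L]) (auto simp: direction_def)
  next
    case 2
    \<comment> \<open>\<open>L\<close> itself may meet \<open>D\<close> in exactly one point and
      then has a value of the other kind; a parallel line missing \<open>D\<close> does not.\<close>
    then obtain M where M: "M \<in> parallel_class L" "M \<inter> D = {}"
      using exists_parallel_disjoint assms by blast
    then have "M \<in> lines" "L = M \<or> L \<inter> M = {}"
      unfolding parallel_class_def by auto
    then have "M \<in> lines" "parallel_class L = parallel_class M"
      using parallel_class_eq_iff[OF 2(1)] by auto
    then show ?thesis
      using 2(2) M(2) by (intro image_eqI[of _ _ M]) (auto simp: direction_def)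
  qed
qed

lemma card_direction_image:
  assumes "D \<subseteq> points" "card D < order" "order \<ge> 2"
  shows "card (direction D ` lines) = order + card D + 1"
proof -
  have "finite D"
    using assms(1) finite_points finite_subset by blast
  have "card (direction D ` lines)
      = card (Inl ` (\<lambda>d. {d}) ` D :: ('a set + 'a set set) set)
        + card (Inr ` parallel_class ` lines :: ('a set + 'a set set) set)"
    unfolding direction_image[OF assms]
    using \<open>finite D\<close> finite_lines by (intro card_Un_disjoint) auto
  also have "\<dots> = card D + card (parallel_class ` lines)"
    by (simp add: card_image inj_on_def)
  finally show ?thesis
    using card_parallel_classes[OF assms(3)] by simp
qed

section \<open>The residual space and its parallelism\<close>

lemma linear_space_residual:
  assumes "D \<subseteq> points" "card D \<le> order - 2" "order \<ge> 2"
  shows "linear_space (points - D) (residual_lines lines D)"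
proof
  show "L \<subseteq> points - D" if "L \<in> residual_lines lines D" for L
    using that lines_subset unfolding residual_lines_def by blast
  show "\<exists>L\<in>residual_lines lines D. x \<in> L \<and> y \<in> L"
    if "x \<in> points - D" "y \<in> points - D" "x \<noteq> y" for x y
    using joining_line[of x y] that unfolding residual_lines_def by blast
  show "x = y" if "L \<in> residual_lines lines D" "M \<in> residual_lines lines D" "L \<noteq> M"
    "x \<in> L \<inter> M" "y \<in> L \<inter> M" for L M x y
    using that meet_at_most_one unfolding residual_lines_def by blast
  show "\<exists>x\<in>L. \<exists>y\<in>L. x \<noteq> y" if L: "L \<in> residual_lines lines D" for L
  proof -
    obtain M where M: "M \<in> lines" "L = M - D"
      using L unfolding residual_lines_def by blast
    \<comment> \<open>At least \<open>order - (order - 2) = 2\<close> points survive on each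
      line.\<close>
    have "card M - card D \<le> card (M - D)"
      by (rule diff_card_le_card_Diff) (use assms(1) finite_points finite_subset in blast)
    then have "\<not> card L \<le> Suc 0"
      using assms(2,3) card_line[OF M(1)] unfolding M(2) by linarith
    moreover have "finite L"
      using M finite_line by simp
    ultimately show ?thesis
      by (auto simp: card_le_Suc0_iff_eq)
  qed
qed

text \<open>\<open>direction D\<close> is defined on full lines while \<open>varpi\<close> relates
  residual ones. Since \<open>L\<close> is determined by \<open>L - D\<close>, composing with the
  inverse of the restriction carries the map over without changing its values.\<close>

lemma varpi_eq_kernel:
  assumes "D \<subseteq> points" "card D \<le> order - 2" "order \<ge> 3"
  defines "f \<equiv> direction D \<circ> inv_into lines (\<lambda>L. L - D)"
  shows "varpi lines D
    = {(x, y). x \<in> residual_lines lines D \<and> y \<in> residual_lines lines D \<and> f x = f y}"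
    and "f ` residual_lines lines D = direction D ` lines"
proof -
  have f: "f (L - D) = direction D L" if "L \<in> lines" for L
    using inv_into_f_f[OF inj_on_residual[OF assms(1-3)] that] by (simp add: f_def)
  show "varpi lines D
    = {(x, y). x \<in> residual_lines lines D \<and> y \<in> residual_lines lines D \<and> f x = f y}"
  proof (intro equalityI subrelI)
    fix x y assume "(x, y) \<in> varpi lines D"
    then obtain L M where "x = L - D" "y = M - D" "L \<in> lines" "M \<in> lines" "varpi_cond D L M"
      unfolding varpi_def by blast
    then show "(x, y)
      \<in> {(x, y). x \<in> residual_lines lines D \<and> y \<in> residual_lines lines D \<and> f x = f y}"
      by (auto simp: residual_lines_def f varpi_cond_iff)
  next
    fix x y assume "(x, y)
      \<in> {(x, y). x \<in> residual_lines lines D \<and> y \<in> residual_lines lines D \<and> f x = f y}"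
    then obtain L M where "x = L - D" "y = M - D" "L \<in> lines" "M \<in> lines" "f x = f y"
      unfolding residual_lines_def by blast
    then show "(x, y) \<in> varpi lines D"
      by (simp add: varpi_iff[OF assms(1-3)] varpi_cond_iff f)
  qed
  show "f ` residual_lines lines D = direction D ` lines"
    unfolding residual_lines_def Setcompr_eq_image Collect_mem_eq image_image
    using f by (rule image_cong[OF refl])
qed

text \<open>Distinct lines meeting \<open>D\<close> in the same single point \<open>d\<close> have
  only \<open>d\<close> in common, and \<open>d\<close> is removed; in the other case the lines are
  disjoint from the start.\<close>

lemma varpi_cond_disjoint:
  assumes "L \<in> lines" "M \<in> lines" "varpi_cond D L M" "L \<noteq> M"
  shows "(L - D) \<inter> (M - D) = {}"
proof (cases "card (L \<inter> D) = 1")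
  case True
  then obtain d where "L \<inter> D = {d}" "M \<inter> D = {d}"
    using assms(3) by (auto simp: varpi_cond_def card_1_singleton_iff)
  then show ?thesis
    using line_eqI[OF assms(1,2), of d] assms(4) by blast
next
  case False
  then show ?thesis
    using assms(3,4) unfolding varpi_cond_def by blast
qed

end

theorem theorem31:
  fixes G :: "'a set" and \<L> :: "'a set set" and D :: "'a set" and n k :: nat
  assumes "affine_plane n G \<L>"
    and "n \<ge> 3"
    and "D \<subseteq> G"
    and "card D = k"
    and "k \<le> n - 2"
  shows "parallelism (G - D) (residual_lines \<L> D) (varpi \<L> D)
    \<and> card (residual_lines \<L> D // varpi \<L> D) = n + k + 1"
proof -
  interpret affine_plane n G \<L>
    by (fact assms(1))
  have D: "card D \<le> n - 2"
    using assms(4,5) by simp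
  note kernel = varpi_eq_kernel[OF assms(3) D assms(2)]
  interpret residual: linear_space "G - D" "residual_lines \<L> D"
    using linear_space_residual[OF assms(3) D] assms(2) by simp
  have "parallelism (G - D) (residual_lines \<L> D) (varpi \<L> D)"
  proof
    show "equiv (residual_lines \<L> D) (varpi \<L> D)"
      unfolding kernel(1) by (rule equiv_kernel_on)
    show "X \<inter> Y = {}" if "(X, Y) \<in> varpi \<L> D" "X \<noteq> Y" for X Y
      using that varpi_cond_disjoint unfolding varpi_def by blast
  qed
  \<comment> \<open>Blocks correspond to values of the kernel map, which are the values of
    \<open>direction D\<close> on the original lines.\<close>
  moreover have "card (residual_lines \<L> D // varpi \<L> D) = card (direction D ` \<L>)"
    unfolding kernel(1) card_quotient_kernel_on kernel(2) ..
  ultimately show ?thesis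
    using card_direction_image[OF assms(3)] assms(2,4,5) by simp
qed

end
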